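(* Let $\rho\in\mathbb{C}$ with $|\rho|<1$, let $x\in(0,\infty)$, and let $a,b,c,d,h$ be complex parameters with positive real parts, such that the non-real parameters occur in conjugate pairs among $a,b,c,d$ and among $a,b,c,h$. Then $$ {}_2F_1\!\left(\begin{matrix}a+ix,\ c+ix\\ a+c\end{matrix};\rho\right){}_2F_1\!\left(\begin{matrix}b-ix,\ d-ix\\ b+d\end{matrix};\rho\right) =\sum_{k=0}^\infty \frac{(k+a+b+c+d-1)_k}{(k+a+b+c+h-1)_k\,(a+c)_k\,(b+d)_k\,k!} $$ $$ \times\ {}_4F_3\!\left(\begin{matrix}d-h,\ 2k+a+b+c+d-1,\ k+a+b,\ k+b+c\\ k+a+b+c+d-1,\ 2k+a+b+c+h,\ k+b+d\end{matrix};\rho\right)\rho^k\,W_k(x^2;a,b,c,h). $$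
   Context: The Pochhammer symbol is $(z)_n=\prod_{i=1}^n(z+i-1)$ for $z\in\mathbb{C}$, $n\in\{0,1,2,\dots\}$ (so $(z)_0=1$). For $a_1,\dots,a_p\in\mathbb{C}$ and $b_1,\dots,b_q\in\mathbb{C}\setminus\{0,-1,-2,\dots\}$ the generalized hypergeometric function is ${}_pF_q(a_1,\dots,a_p;b_1,\dots,b_q;z)=\sum_{n\ge0}\frac{(a_1)_n\cdots(a_p)_n}{(b_1)_n\cdots(b_q)_n}\frac{z^n}{n!}$; for $p=q+1$ it is defined by this series in the unit disk $|z|<1$. The Wilson polynomials are $$W_n(x^2;a,b,c,d)=(a+b)_n(a+c)_n(a+d)_n\ {}_4F_3\!\left(\begin{matrix}-n,\ n+a+b+c+d-1,\ a+ix,\ a-ix\\ a+b,\ a+c,\ a+d\end{matrix};1\right),$$ where the parameters are positive, or complex with positive real parts occurring in conjugate pairs.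
   Formalization: When a+b+c+d=1 the k=0 term's 4F3 has lower parameter a+b+c+d-1=0 and is undefined; it is read there as the 3F2 with upper d-h, a+b, b+c and lower a+b+c+h, b+d, obtained by cancelling the equal upper and lower parameters. *)

theory Defs
  imports "HOL-Analysis.Analysis"
begin

(* pFq for as = [a_1, ..., a_p] and bs = [b_1, ..., b_q].  No lower parameter may be a
   non-positive integer: otherwise x / 0 = 0 silently drops all terms from some index on, and
   the value has no mathematical meaning. *)
definition hypergeom :: "complex list \<Rightarrow> complex list \<Rightarrow> complex \<Rightarrow> complex" where
  "hypergeom as bs z =
     (\<Sum>n. (\<Prod>a\<leftarrow>as. pochhammer a n) / (\<Prod>b\<leftarrow>bs. pochhammer b n) * (z ^ n / fact n))"

lemma hypergeom_eq_eval_fps: "hypergeom as bs z = eval_fps (fps_hypergeo as bs 1) z"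
proof -
  have "foldl (\<lambda>r a. r * pochhammer a n) y xs = y * (\<Prod>a\<leftarrow>xs. pochhammer a n)"
    for n and y :: complex and xs
    by (induction xs arbitrary: y) (auto simp: mult_ac)
  then show ?thesis
    by (simp add: hypergeom_def eval_fps_def)
qed

(* wilson n x a b c d is W_n(x^2; a, b, c, d): the argument is x, not x^2.  The series
   terminates because pochhammer (- of_nat n) m = 0 for m > n. *)
definition wilson ::
    "nat \<Rightarrow> complex \<Rightarrow> complex \<Rightarrow> complex \<Rightarrow> complex \<Rightarrow> complex \<Rightarrow> complex" where
  "wilson n x a b c d =
     pochhammer (a + b) n * pochhammer (a + c) n * pochhammer (a + d) n *
     hypergeom [- of_nat n, of_nat n + a + b + c + d - 1, a + \<i> * x, a - \<i> * x]
       [a + b, a + c, a + d] 1"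

(* The non-real members of a parameter family occur in conjugate pairs, with multiplicity. *)
definition conj_pairs :: "complex multiset \<Rightarrow> bool" where
  "conj_pairs M \<longleftrightarrow> (\<forall>z. z \<notin> \<real> \<longrightarrow> count M (cnj z) = count M z)"

end

(*
  Put u = ix.  Both sides are power series in rho.  The coefficient p_n of rho^n on the left is a
  Cauchy product; two applications of the Pfaff-Saalschuetz sum (in effect Whipple's
  transformation of balanced 4F3's) expand it in the basis (a+u)_k (a-u)_k, which identifies
  p_n with W_n(x^2; a,b,c,d) / ((a+c)_n (b+d)_n n!).  The Wilson polynomials with last parameter d
  are then re-expanded in those with last parameter h; comparing the coefficients of
  (a+u)_j (a-u)_j, this is a terminating very-well-poised 5F4 sum.  Both hypergeometric sums are
  polynomial identities proved by telescoping.

  It remains to rearrange the double series over (k, m), n = k + m.  For it to converge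
  absolutely, W_k is bounded through its own generating function, and every other factor is a
  ratio of Pochhammer symbols of equal length, hence O(R^length) for each R > 1, uniformly in the
  starting index.
*)
theory Submission
  imports Defs
begin

section \<open>Two terminating hypergeometric sums by telescoping\<close>

text \<open>The induction step of both summation theorems: \<open>F\<close> is the summand,
  \<open>T\<close> the summand with one parameter shifted and the length reduced by one, and
  \<open>K\<close> the certificate. In both applications the boundary term \<open>K n\<close>
  vanishes through a binomial coefficient.\<close>

lemma sum_eq_by_telescoping:
  fixes F T K :: "nat \<Rightarrow> 'a::comm_ring_1"
  assumes "F 0 = q * T 0 - K 0"
    and "\<And>k. k < n \<Longrightarrow> F (Suc k) = q * T (Suc k) - K (Suc k) + K k"
  shows "(\<Sum>k\<le>n. F k) = q * (\<Sum>k\<le>n. T k) - K n"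
  using assms(2)
proof (induction n)
  case 0
  then show ?case using assms(1) by simp
next
  case (Suc n)
  have "(\<Sum>k\<le>Suc n. F k) = (\<Sum>k\<le>n. F k) + F (Suc n)" by simp
  also have "\<dots> = q * (\<Sum>k\<le>n. T k) - K n + (q * T (Suc n) - K (Suc n) + K n)"
    using Suc by simp
  finally show ?case by (simp add: distrib_left)
qed

lemma Suc_times_binomial_Suc:
  "of_nat (Suc k) * of_nat (n choose Suc k) = of_nat (n - k) * (of_nat (n choose k) :: 'a::comm_semiring_1)"
proof (cases n)
  case (Suc m)
  have "Suc k * (Suc m choose Suc k) = (Suc m - k) * (Suc m choose k)"
    by (metis binomial_absorb_comp binomial_absorption Suc_times_binomial_eq mult.commute diff_Suc_1 binomial_absorption)
  then show ?thesis using Suc by (metis of_nat_mult)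
qed auto

text \<open>The classical form \<open>\<^sub>3F\<^sub>2(-n, \<alpha>, \<beta>; \<gamma>, 1 + \<alpha> + \<beta> - \<gamma> - n; 1)\<close> with \<open>\<delta> = \<gamma> - \<alpha> - \<beta>\<close>,
  multiplied by the denominators.  The induction shifts \<open>\<delta>\<close> to \<open>\<delta> + 1\<close>.\<close>

lemma pfaff_saalschuetz:
  fixes \<alpha> \<beta> \<delta> :: "'a::field_char_0"
  shows "(\<Sum>k\<le>n. of_nat (n choose k) * pochhammer \<alpha> k * pochhammer \<beta> k *
            pochhammer (\<alpha> + \<beta> + \<delta> + of_nat k) (n - k) * pochhammer \<delta> (n - k))
         = pochhammer (\<alpha> + \<delta>) n * pochhammer (\<beta> + \<delta>) n"
proof (induction n arbitrary: \<delta>)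
  case 0
  then show ?case by simp
next
  case (Suc n)
  define \<gamma> where "\<gamma> = \<alpha> + \<beta> + \<delta>"
  define F where "F k = of_nat (Suc n choose k) * pochhammer \<alpha> k * pochhammer \<beta> k *
            pochhammer (\<gamma> + of_nat k) (Suc n - k) * pochhammer \<delta> (Suc n - k)" for k
  define T where "T k = of_nat (n choose k) * pochhammer \<alpha> k * pochhammer \<beta> k *
            pochhammer (\<gamma> + 1 + of_nat k) (n - k) * pochhammer (\<delta> + 1) (n - k)" for k
  define K where "K k = T k * (\<alpha> + of_nat k) * (\<beta> + of_nat k)" for k
  have F0: "F 0 = (\<alpha> + \<delta>) * (\<beta> + \<delta>) * T 0 - K 0"
    by (simp add: F_def T_def K_def \<gamma>_def pochhammer_rec algebra_simps)
  have FS: "F (Suc k) = (\<alpha> + \<delta>) * (\<beta> + \<delta>) * T (Suc k) - K (Suc k) + K k" if "k < Suc n" for k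
  proof (cases "k = n")
    case True
    then show ?thesis
      by (simp add: F_def T_def K_def pochhammer_Suc binomial_eq_0)
  next
    case False
    then obtain r where n: "n = Suc (k + r)"
      using \<open>k < Suc n\<close> by (metis add_Suc_right less_Suc_eq less_iff_Suc_add)
    define p where "p = pochhammer \<alpha> (Suc k) * pochhammer \<beta> (Suc k) *
       pochhammer (\<gamma> + of_nat (Suc k)) (Suc r) * pochhammer (\<delta> + 1) r"
    \<comment> \<open>\<open>T (Suc k)\<close> lacks the factor \<open>\<gamma> + j\<close>,
      \<open>j = Suc k\<close>, of \<open>p\<close>. It is supplied below by the factorization
      \<open>(\<alpha> + \<delta>) * (\<beta> + \<delta>) - (\<alpha> + j) * (\<beta> + j) =
      (\<delta> - j) * (\<gamma> + j)\<close>.\<close>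
    have pT: "T (Suc k) * (\<gamma> + of_nat (Suc k)) = of_nat (n choose Suc k) * p"
      unfolding T_def p_def pochhammer_rec[of "\<gamma> + of_nat (Suc k)"] by (simp add: n algebra_simps)
    have FSk: "F (Suc k) = of_nat (Suc n choose Suc k) * \<delta> * p"
      unfolding F_def p_def by (simp add: n pochhammer_rec[of \<delta>])
    have KSk: "K k = of_nat (n choose k) * (\<delta> + 1 + of_nat r) * p"
      unfolding K_def T_def p_def by (simp add: n pochhammer_Suc add_ac)
    have "of_nat (Suc k) * of_nat (n choose Suc k) = of_nat (Suc r) * (of_nat (n choose k) :: 'a)"
      using Suc_times_binomial_Suc[of k n] by (simp add: n)
    then have "F (Suc k) - K k = (\<delta> - of_nat (Suc k)) * (of_nat (n choose Suc k) * p)"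
      unfolding FSk KSk by (simp add: algebra_simps)
    also have "\<dots> = (\<alpha> + \<delta>) * (\<beta> + \<delta>) * T (Suc k) - K (Suc k)"
      unfolding pT[symmetric] K_def \<gamma>_def by (simp add: algebra_simps)
    finally show ?thesis by (simp add: algebra_simps)
  qed
  have "(\<Sum>k\<le>Suc n. F k) = (\<alpha> + \<delta>) * (\<beta> + \<delta>) * (\<Sum>k\<le>Suc n. T k) - K (Suc n)"
    by (intro sum_eq_by_telescoping F0 FS)
  also have "\<dots> = (\<alpha> + \<delta>) * (\<beta> + \<delta>) * (\<Sum>k\<le>n. T k)"
    by (simp add: T_def K_def binomial_eq_0)
  also have "(\<Sum>k\<le>n. T k) = pochhammer (\<alpha> + (\<delta> + 1)) n * pochhammer (\<beta> + (\<delta> + 1)) n"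
    unfolding T_def \<gamma>_def using Suc.IH[of "\<delta> + 1"] by (simp add: add_ac)
  finally show ?case
    by (simp add: F_def \<gamma>_def pochhammer_rec[of "_ + \<delta>"] algebra_simps)
qed

lemma pochhammer_reflect:
  fixes z :: "'a::comm_ring_1"
  shows "pochhammer (1 - of_nat n - z) n = (-1) ^ n * pochhammer z n"
  using pochhammer_minus[of "z + of_nat n - 1" n]
  by (simp add: algebra_simps)

text \<open>The terminating \<open>\<^sub>5F\<^sub>4(A, 1 + A/2, B, C, -M; A/2, 1 + A - B, 1 + A - C, 1 + A + M; 1)\<close> with
  \<open>C = A + M + e\<close> and \<open>D = 1 + A - B\<close>.  In the denominator \<open>(A + i)\<^sub>i (A + 2i + 1)\<^bsub>M-i\<^esub>\<close> is written for
  \<open>(A + i)\<^bsub>M+1\<^esub> / (A + 2i)\<close>, which is \<open>0 / 0\<close> for \<open>A = i = 0\<close>.  The induction shifts \<open>e\<close> to \<open>e + 1\<close>,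
  which leaves \<open>C\<close> unchanged.\<close>

lemma well_poised_sum:
  fixes B D e :: "'a::field_char_0"
  assumes "A = B + D - 1" and nz: "\<And>k. A + of_nat (Suc k) \<noteq> 0"
  shows "(\<Sum>i\<le>M. of_nat (M choose i) * pochhammer e (M - i) * pochhammer (A + of_nat M + e) i *
            pochhammer B i * pochhammer (D + of_nat i) (M - i) /
            (pochhammer (A + of_nat i) i * pochhammer (A + of_nat (2 * i) + 1) (M - i)))
         = pochhammer (B + e) M"
proof (induction M arbitrary: e)
  case 0
  then show ?case by simp
next
  case (Suc M)
  define C where "C = A + of_nat (Suc M) + e"
  define H where "H M i = pochhammer (A + of_nat i) i * pochhammer (A + of_nat (2 * i) + 1) (M - i)"
    for M i
  define F where "F i = of_nat (Suc M choose i) * pochhammer e (Suc M - i) * pochhammer C i *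
            pochhammer B i * pochhammer (D + of_nat i) (Suc M - i) / H (Suc M) i" for i
  define T where "T i = of_nat (M choose i) * pochhammer (e + 1) (M - i) * pochhammer C i *
            pochhammer B i * pochhammer (D + of_nat i) (M - i) / H M i" for i
  \<comment> \<open>For \<open>A + 2i \<noteq> 0\<close> and \<open>i \<le> M\<close> this is
    \<open>T i * (B + i) * (C + i) * (A + i) / ((A + 2i) * (A + i + M + 1))\<close>. The form chosen
    has no zero denominator even for \<open>A = i = 0\<close>.\<close>
  define K where "K i = of_nat (M choose i) * pochhammer (e + 1) (M - i) * pochhammer C (Suc i) *
            pochhammer B (Suc i) * pochhammer (D + of_nat i) (M - i) /
            pochhammer (A + of_nat (Suc i)) (Suc M)" for i
  have nz': "A + of_nat (Suc k) + of_nat j \<noteq> 0" for k j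
    using nz[of "k + j"] by (simp add: add_ac)
  have pnz: "pochhammer (A + of_nat (Suc k)) j \<noteq> 0" for k j
    using nz'[of k] by (simp add: pochhammer_eq_0_iff eq_neg_iff_add_eq_0)
  have F0: "F 0 = (B + e) * T 0 - K 0"
  proof -
    have nzs: "pochhammer (A + 1) M \<noteq> 0" "A + 1 + of_nat M \<noteq> 0"
      using pnz[of 0 M] nz'[of 0 M] by auto
    define p where "p = pochhammer (e + 1) M * pochhammer D M / (pochhammer (A + 1) M * (A + 1 + of_nat M))"
    have "F 0 = e * (D + of_nat M) * p"
      by (simp add: F_def H_def p_def pochhammer_rec[of e] pochhammer_Suc[of D] pochhammer_Suc[of "A + 1"])
    moreover have "T 0 = (A + 1 + of_nat M) * p"
      using nzs by (simp add: T_def H_def p_def)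
    moreover have "K 0 = C * B * p"
      by (simp add: K_def p_def pochhammer_Suc[of "A + 1"])
    ultimately show ?thesis
      unfolding C_def assms(1) by (simp add: algebra_simps)
  qed
  have Hrec: "H n (Suc k) * (A + of_nat (2 * Suc k)) = pochhammer (A + of_nat (Suc k)) (Suc n)"
    if "Suc k \<le> n" for k n
  proof -
    have "Suc n = Suc k + Suc (n - Suc k)" using that by simp
    then show ?thesis
      unfolding H_def
      by (smt (verit) add.assoc pochhammer_product' pochhammer_rec mult.assoc mult.commute of_nat_add mult_2 of_nat_Suc)
  qed
  have FS: "F (Suc k) = (B + e) * T (Suc k) - K (Suc k) + K k" if "k < Suc M" for k
  proof (cases "k = M")
    case True
    then show ?thesis
      by (simp add: F_def T_def K_def H_def binomial_eq_0)
  next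
    case False
    then obtain r where M: "M = Suc (k + r)"
      using \<open>k < Suc M\<close> by (metis add_Suc_right less_Suc_eq less_iff_Suc_add)
    define i :: 'a where "i = of_nat (Suc k)"
    \<comment> \<open>\<open>Z\<close> is the one factor by which the denominators of
      \<open>F (Suc k)\<close> and \<open>K (Suc k)\<close> exceed
      \<open>pochhammer (A + i) (Suc M)\<close>. The recurrence is therefore proved after
      multiplication by \<open>Z\<close>.\<close>
    define Z where "Z = A + i + of_nat (Suc M)"
    define p where "p = pochhammer (e + 1) r * pochhammer C (Suc k) * pochhammer B (Suc k) *
      pochhammer (D + i) r / pochhammer (A + i) (Suc M)"
    \<comment> \<open>All three binomial coefficients are polynomial multiples of \<open>g\<close>,
      so that after extracting \<open>g * p\<close> only a polynomial identity in \<open>i\<close>,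
      \<open>r\<close>, \<open>B\<close>, \<open>D\<close>, \<open>e\<close> remains.\<close>
    define g where "g = of_nat (M choose k) / i"
    have i0: "i \<noteq> 0" unfolding i_def by (rule of_nat_neq_0)
    have Z0: "Z \<noteq> 0" unfolding Z_def i_def by (rule nz')
    have Mi: "of_nat M = i + of_nat r" by (simp add: M i_def)
    have c0: "of_nat (M choose k) = i * g" using i0 by (simp add: g_def)
    have c1: "of_nat (M choose Suc k) = (of_nat r + 1) * g"
    proof -
      have "i * of_nat (M choose Suc k) = of_nat (M - k) * of_nat (M choose k)"
        unfolding i_def by (rule Suc_times_binomial_Suc)
      also have "\<dots> = i * ((of_nat r + 1) * g)"
        unfolding c0 by (simp add: M)
      finally show ?thesis using i0 by simp
    qed
    have c2: "of_nat (Suc M choose Suc k) = (of_nat M + 1) * g"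
      by (simp add: c0 c1 Mi algebra_simps)
    have A2: "A + of_nat (2 * Suc k) = A + 2 * i" by (simp add: i_def)
    have A2nz: "A + 2 * i \<noteq> 0" using nz[of "Suc (2 * k)"] by (simp add: i_def algebra_simps)
    have H1: "H M (Suc k) = pochhammer (A + i) (Suc M) / (A + 2 * i)"
      using Hrec[of k M, unfolded A2, folded i_def] A2nz M by (simp add: nonzero_eq_divide_eq)
    have H2: "H (Suc M) (Suc k) = pochhammer (A + i) (Suc M) * Z / (A + 2 * i)"
    proof -
      have "Suc k \<le> Suc M" using M by simp
      from Hrec[OF this, unfolded A2 pochhammer_Suc[of _ "Suc M"], folded i_def, folded Z_def] A2nz
      show ?thesis by (simp only: nonzero_eq_divide_eq not_False_eq_True simp_thms)
    qed
    have r: "Suc M - Suc k = Suc r" "M - Suc k = r" "M - k = Suc r"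
      by (simp_all add: M)
    have pD: "pochhammer (D + i) (Suc r) = pochhammer (D + i) r * (D + of_nat M)"
      by (simp add: pochhammer_Suc Mi add_ac)
    have pD': "pochhammer (D + of_nat k) (Suc r) = (D + i - 1) * pochhammer (D + i) r"
      by (simp add: pochhammer_rec i_def add_ac)
    have pe: "pochhammer (e + 1) (Suc r) = pochhammer (e + 1) r * (e + 1 + of_nat r)"
      by (simp add: pochhammer_Suc)
    have FSk: "F (Suc k) * Z = (of_nat M + 1) * g * e * (D + of_nat M) * (A + 2 * i) * p"
      unfolding F_def H2 c2 p_def i_def[symmetric] r pD pochhammer_rec[of e] using Z0 by simp
    have TSk: "T (Suc k) = (of_nat r + 1) * g * (A + 2 * i) * p"
      unfolding T_def H1 c1 p_def i_def[symmetric] r by simp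
    have Kk: "K k = i * g * (e + 1 + of_nat r) * (D + i - 1) * p"
      unfolding K_def c0 p_def i_def[symmetric] r pD' pe by simp
    have KSk: "K (Suc k) * Z = (of_nat r + 1) * g * (C + i) * (B + i) * (A + i) * p"
    proof -
      have "(A + i) * pochhammer (A + of_nat (Suc (Suc k))) (Suc M) = pochhammer (A + i) (Suc M) * Z"
        using pochhammer_rec[of "A + i" "Suc M"] pochhammer_Suc[of "A + i" "Suc M"]
        by (simp add: Z_def i_def add_ac)
      moreover have "A + i \<noteq> 0" using nz[of k] by (simp add: i_def)
      ultimately have "1 / pochhammer (A + of_nat (Suc (Suc k))) (Suc M) * Z =
          (A + i) / pochhammer (A + i) (Suc M)"
        using pnz[of "Suc k" "Suc M"] pnz[of k "Suc M"]
        by (simp add: field_simps i_def del: of_nat_Suc)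
      moreover have "K (Suc k) * Z = (of_nat r + 1) * g * pochhammer (e + 1) r *
          (pochhammer C (Suc k) * (C + i)) * (pochhammer B (Suc k) * (B + i)) * pochhammer (D + i) r *
          (1 / pochhammer (A + of_nat (Suc (Suc k))) (Suc M) * Z)"
        unfolding K_def c1 by (simp add: M pochhammer_Suc[of _ "Suc k"] i_def)
      ultimately show ?thesis
        by (simp add: p_def)
    qed
    have "F (Suc k) * Z = ((B + e) * T (Suc k) - K (Suc k) + K k) * Z"
      unfolding ring_distribs FSk KSk TSk Kk unfolding C_def Z_def Mi assms(1) of_nat_Suc
      by (simp only: ring_distribs) (simp add: algebra_simps)
    then show ?thesis using Z0 by simp
  qed
  have "(\<Sum>k\<le>Suc M. F k) = (B + e) * (\<Sum>k\<le>Suc M. T k) - K (Suc M)"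
    by (intro sum_eq_by_telescoping F0 FS)
  also have "\<dots> = (B + e) * (\<Sum>k\<le>M. T k)"
    by (simp add: T_def K_def binomial_eq_0)
  also have "(\<Sum>k\<le>M. T k) = pochhammer (B + (e + 1)) M"
    unfolding T_def H_def C_def using Suc.IH[of "e + 1"] by (simp add: add_ac)
  finally show ?case
    by (simp add: F_def C_def H_def pochhammer_rec[of "B + e"] algebra_simps)
qed

section \<open>The product of the two 2F1 series and its expansion in Wilson polynomials\<close>

lemma pochhammer_nonzero:
  fixes z :: complex
  assumes "Re z > 0"
  shows "pochhammer z n \<noteq> 0"
proof -
  have "z \<noteq> - of_nat k" for k
    using assms by auto
  then show ?thesis by (simp add: pochhammer_eq_0_iff)
qed

lemma sum_triangle_shift:
  fixes g :: "nat \<Rightarrow> nat \<Rightarrow> 'a::comm_monoid_add"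
  shows "(\<Sum>j\<le>n. \<Sum>k\<le>j. g j k) = (\<Sum>k\<le>n. \<Sum>i\<le>n - k. g (k + i) k)"
  unfolding sum.Sigma[OF finite_atMost ballI[OF finite_atMost]]
  by (rule sum.reindex_bij_witness[where i = "\<lambda>(k, i). (k + i, k)" and j = "\<lambda>(j, k). (k, j - k)"]) auto

text \<open>The coefficient of \<open>z\<^sup>n\<close> in
  \<open>\<^sub>2F\<^sub>1(a + u, c + u; a + c; z) \<^sub>2F\<^sub>1(b - u, d - u; b + d; z)\<close>.\<close>

definition product_coeff :: "complex \<Rightarrow> complex \<Rightarrow> complex \<Rightarrow> complex \<Rightarrow> complex \<Rightarrow> nat \<Rightarrow> complex" where
  "product_coeff a b c d u n = (\<Sum>j\<le>n.
     pochhammer (a + u) j * pochhammer (c + u) j / (pochhammer (a + c) j * fact j) *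
     (pochhammer (b - u) (n - j) * pochhammer (d - u) (n - j) / (pochhammer (b + d) (n - j) * fact (n - j))))"

text \<open>A first Pfaff-Saalschuetz sum, \<open>expand\<close>, trades
  \<open>pochhammer (c + u) j\<close> for a sum over \<open>k\<close> containing
  \<open>pochhammer (a - u) k\<close>. After the order of summation is interchanged, a second one
  evaluates the inner sum, which removes \<open>b - u\<close> and \<open>d - u\<close>. What remains
  depends on \<open>u\<close> only through \<open>(a + u)_k (a - u)_k\<close>.\<close>

lemma product_coeff_eq:
  fixes a b c d u :: complex
  assumes ac: "Re (a + c) > 0" and bd: "Re (b + d) > 0"
  shows "product_coeff a b c d u n =
    (\<Sum>k\<le>n. (-1) ^ k * of_nat (n choose k) * pochhammer (of_nat n + a + b + c + d - 1) k *
       pochhammer (a + u) k * pochhammer (a - u) k *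
       pochhammer (a + b + of_nat k) (n - k) * pochhammer (a + d + of_nat k) (n - k) /
       (pochhammer (a + c) k * pochhammer (b + d) n * fact n))"
proof -
  define X where "X = a + b + d - u"
  define S where "S = of_nat n + a + b + c + d - 1"
  have expand: "pochhammer (c + u) j / (pochhammer (a + c) j * pochhammer (b + d) (n - j)) =
      (\<Sum>k\<le>j. (-1) ^ k * of_nat (j choose k) * pochhammer (a - u) k * pochhammer S k *
         pochhammer (X + of_nat (n - j) + of_nat k) (j - k) / pochhammer (a + c) k) / pochhammer (b + d) n"
    (is "_ = (\<Sum>k\<le>j. ?g k) / _") if j: "j \<le> n" for j
  proof -
    \<comment> \<open>With this \<delta> the parameters of the Saalschuetz sum become
      \<open>a + c\<close>, \<open>c + u\<close> and \<open>1 - n - (b + d)\<close>. Reflection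
      turns the Pochhammer symbol of the last into the final \<open>j\<close> factors of
      \<open>pochhammer (b + d) n\<close>.\<close>
    define \<delta> where "\<delta> = 1 - of_nat n - X"
    have e1: "a - u + S + \<delta> = a + c" and e2: "a - u + \<delta> = 1 - of_nat j - (b + d + of_nat (n - j))"
      and e3: "S + \<delta> = c + u"
      using j by (simp_all add: \<delta>_def S_def X_def of_nat_diff algebra_simps)
    have "(-1) ^ j * pochhammer (b + d + of_nat (n - j)) j * pochhammer (c + u) j =
       (\<Sum>k\<le>j. of_nat (j choose k) * pochhammer (a - u) k * pochhammer S k *
            pochhammer (a + c + of_nat k) (j - k) * pochhammer \<delta> (j - k))"
      using pfaff_saalschuetz[where n = j and \<alpha> = "a - u" and \<beta> = S and \<delta> = \<delta>]
      unfolding e1 e2 e3 pochhammer_reflect by simp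
    also have "\<dots> = (\<Sum>k\<le>j. (-1) ^ j * pochhammer (a + c) j * ?g k)"
    proof (rule sum.cong, simp)
      fix k assume "k \<in> {..j}"
      then have k: "k \<le> j" by simp
      have d: "\<delta> = 1 - of_nat (j - k) - (X + of_nat (n - j) + of_nat k)"
        using j k by (simp add: \<delta>_def of_nat_diff algebra_simps)
      have "(-1 :: complex) ^ (j - k) = (-1) ^ j * (-1) ^ k"
        using k by (metis (no_types, lifting) le_add_diff_inverse2 minus_one_power_iff even_add mult_1 mult_minus1 minus_minus)
      moreover have "pochhammer (a + c) j = pochhammer (a + c) k * pochhammer (a + c + of_nat k) (j - k)"
        using k pochhammer_product by blast
      moreover have "pochhammer (a + c) k \<noteq> 0" using ac by (rule pochhammer_nonzero)
      ultimately show "of_nat (j choose k) * pochhammer (a - u) k * pochhammer S k *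
            pochhammer (a + c + of_nat k) (j - k) * pochhammer \<delta> (j - k) =
          (-1) ^ j * pochhammer (a + c) j * ?g k"
        unfolding d pochhammer_reflect by (simp add: field_simps)
    qed
    also have "\<dots> = (-1) ^ j * (pochhammer (a + c) j * (\<Sum>k\<le>j. ?g k))"
      by (simp only: sum_distrib_left mult.assoc)
    finally have "pochhammer (b + d + of_nat (n - j)) j * pochhammer (c + u) j =
        pochhammer (a + c) j * (\<Sum>k\<le>j. ?g k)"
      by simp
    moreover have "pochhammer (b + d) n = pochhammer (b + d) (n - j) * pochhammer (b + d + of_nat (n - j)) j"
      using j pochhammer_product[of "n - j" n "b + d"] by simp
    moreover have "pochhammer (b + d) n \<noteq> 0" "pochhammer (a + c) j \<noteq> 0"
      using ac bd by (auto intro!: pochhammer_nonzero simp del: plus_complex.sel)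
    ultimately show ?thesis
      by (simp add: field_simps)
  qed
  have "product_coeff a b c d u n = (\<Sum>j\<le>n. \<Sum>k\<le>j.
      of_nat (n choose j) * pochhammer (a + u) j * pochhammer (b - u) (n - j) * pochhammer (d - u) (n - j) *
      ((-1) ^ k * of_nat (j choose k) * pochhammer (a - u) k * pochhammer S k *
         pochhammer (X + of_nat (n - j) + of_nat k) (j - k) / pochhammer (a + c) k) /
      (pochhammer (b + d) n * fact n))"
    unfolding product_coeff_def
  proof (rule sum.cong, simp)
    fix j assume "j \<in> {..n}"
    then have j: "j \<le> n" by simp
    have "pochhammer (a + u) j * pochhammer (c + u) j / (pochhammer (a + c) j * fact j) *
     (pochhammer (b - u) (n - j) * pochhammer (d - u) (n - j) / (pochhammer (b + d) (n - j) * fact (n - j)))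
     = of_nat (n choose j) * pochhammer (a + u) j * pochhammer (b - u) (n - j) * pochhammer (d - u) (n - j)
       * (pochhammer (c + u) j / (pochhammer (a + c) j * pochhammer (b + d) (n - j))) / fact n"
      by (simp add: binomial_fact[OF j] mult_ac)
    then show "pochhammer (a + u) j * pochhammer (c + u) j / (pochhammer (a + c) j * fact j) *
     (pochhammer (b - u) (n - j) * pochhammer (d - u) (n - j) / (pochhammer (b + d) (n - j) * fact (n - j)))
      = (\<Sum>k\<le>j. of_nat (n choose j) * pochhammer (a + u) j * pochhammer (b - u) (n - j) * pochhammer (d - u) (n - j) *
      ((-1) ^ k * of_nat (j choose k) * pochhammer (a - u) k * pochhammer S k *
         pochhammer (X + of_nat (n - j) + of_nat k) (j - k) / pochhammer (a + c) k) /
      (pochhammer (b + d) n * fact n))"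
      unfolding expand[OF j] by (simp add: sum_distrib_left sum_distrib_right sum_divide_distrib mult_ac)
  qed
  also have "\<dots> = (\<Sum>k\<le>n. (-1) ^ k * of_nat (n choose k) * pochhammer S k *
       pochhammer (a + u) k * pochhammer (a - u) k *
       (\<Sum>i\<le>n - k. of_nat ((n - k) choose i) * pochhammer (a + u + of_nat k) i *
          pochhammer (b - u) (n - k - i) * pochhammer (d - u) (n - k - i) *
          pochhammer (X + of_nat k + of_nat (n - k - i)) i) /
       (pochhammer (a + c) k * pochhammer (b + d) n * fact n))"
    unfolding sum_triangle_shift
  proof (rule sum.cong, simp)
    fix k assume "k \<in> {..n}"
    then have k: "k \<le> n" by simp
    show "(\<Sum>i\<le>n - k. of_nat (n choose (k + i)) * pochhammer (a + u) (k + i) * pochhammer (b - u) (n - (k + i)) *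
        pochhammer (d - u) (n - (k + i)) *
      ((-1) ^ k * of_nat ((k + i) choose k) * pochhammer (a - u) k * pochhammer S k *
         pochhammer (X + of_nat (n - (k + i)) + of_nat k) (k + i - k) / pochhammer (a + c) k) /
      (pochhammer (b + d) n * fact n)) =
      (-1) ^ k * of_nat (n choose k) * pochhammer S k *
       pochhammer (a + u) k * pochhammer (a - u) k *
       (\<Sum>i\<le>n - k. of_nat ((n - k) choose i) * pochhammer (a + u + of_nat k) i *
          pochhammer (b - u) (n - k - i) * pochhammer (d - u) (n - k - i) *
          pochhammer (X + of_nat k + of_nat (n - k - i)) i) /
       (pochhammer (a + c) k * pochhammer (b + d) n * fact n)"
      unfolding sum_distrib_left sum_divide_distrib
    proof (rule sum.cong, simp)
      fix i assume "i \<in> {..n - k}"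
      then have i: "k + i \<le> n" using k by simp
      have binom: "of_nat (n choose (k + i)) * (of_nat ((k + i) choose k) * y) =
          of_nat (n choose k) * (of_nat ((n - k) choose i) * y)" for y :: complex
        using choose_mult[of k "k + i" n] i
        by (metis add_diff_cancel_left' le_add1 of_nat_mult mult.assoc)
      have X: "X + of_nat (n - (k + i)) + of_nat k = X + of_nat k + of_nat (n - (k + i))"
        by simp
      show "of_nat (n choose (k + i)) * pochhammer (a + u) (k + i) * pochhammer (b - u) (n - (k + i)) *
        pochhammer (d - u) (n - (k + i)) *
      ((-1) ^ k * of_nat ((k + i) choose k) * pochhammer (a - u) k * pochhammer S k *
         pochhammer (X + of_nat (n - (k + i)) + of_nat k) (k + i - k) / pochhammer (a + c) k) /
      (pochhammer (b + d) n * fact n) =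
       (-1) ^ k * of_nat (n choose k) * pochhammer S k *
       pochhammer (a + u) k * pochhammer (a - u) k *
       (of_nat ((n - k) choose i) * pochhammer (a + u + of_nat k) i *
          pochhammer (b - u) (n - k - i) * pochhammer (d - u) (n - k - i) *
          pochhammer (X + of_nat k + of_nat (n - k - i)) i) /
       (pochhammer (a + c) k * pochhammer (b + d) n * fact n)"
        by (simp add: pochhammer_product' binom X mult_ac)
    qed
  qed
  also have "\<dots> = (\<Sum>k\<le>n. (-1) ^ k * of_nat (n choose k) * pochhammer S k *
       pochhammer (a + u) k * pochhammer (a - u) k *
       (pochhammer (a + b + of_nat k) (n - k) * pochhammer (a + d + of_nat k) (n - k)) /
       (pochhammer (a + c) k * pochhammer (b + d) n * fact n))"
  proof (rule sum.cong, simp)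
    fix k
    \<comment> \<open>Reversing the summation by \<open>l = n - k - i\<close> gives the Saalschuetz
      sum with parameters \<open>b - u\<close>, \<open>d - u\<close> and
      \<open>\<delta> = a + u + k\<close>, since \<open>X + k\<close> is their sum.\<close>
    have "(\<Sum>i\<le>n - k. of_nat ((n - k) choose i) * pochhammer (a + u + of_nat k) i *
          pochhammer (b - u) (n - k - i) * pochhammer (d - u) (n - k - i) *
          pochhammer (X + of_nat k + of_nat (n - k - i)) i)
      = (\<Sum>l\<le>n - k. of_nat ((n - k) choose l) * pochhammer (b - u) l * pochhammer (d - u) l *
          pochhammer (b - u + (d - u) + (a + u + of_nat k) + of_nat l) (n - k - l) *
          pochhammer (a + u + of_nat k) (n - k - l))"
    proof (rule sum.reindex_bij_witness[where i = "\<lambda>i. n - k - i" and j = "\<lambda>i. n - k - i"])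
      fix i assume "i \<in> {..n - k}"
      then have i: "n - k - (n - k - i) = i" "(n - k choose (n - k - i)) = (n - k choose i)"
        using binomial_symmetric[of i "n - k"] by simp_all
      have X: "b - u + (d - u) + (a + u + of_nat k) + of_nat (n - k - i) = X + of_nat k + of_nat (n - k - i)"
        by (simp add: X_def algebra_simps)
      show "of_nat ((n - k) choose (n - k - i)) * pochhammer (b - u) (n - k - i) * pochhammer (d - u) (n - k - i) *
          pochhammer (b - u + (d - u) + (a + u + of_nat k) + of_nat (n - k - i)) (n - k - (n - k - i)) *
          pochhammer (a + u + of_nat k) (n - k - (n - k - i)) =
        of_nat ((n - k) choose i) * pochhammer (a + u + of_nat k) i *
          pochhammer (b - u) (n - k - i) * pochhammer (d - u) (n - k - i) *
          pochhammer (X + of_nat k + of_nat (n - k - i)) i"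
        unfolding i X by (simp only: mult_ac)
    qed auto
    also have "\<dots> = pochhammer (a + b + of_nat k) (n - k) * pochhammer (a + d + of_nat k) (n - k)"
      unfolding pfaff_saalschuetz by (simp add: add_ac)
    finally show "(-1) ^ k * of_nat (n choose k) * pochhammer S k *
       pochhammer (a + u) k * pochhammer (a - u) k *
       (\<Sum>i\<le>n - k. of_nat ((n - k) choose i) * pochhammer (a + u + of_nat k) i *
          pochhammer (b - u) (n - k - i) * pochhammer (d - u) (n - k - i) *
          pochhammer (X + of_nat k + of_nat (n - k - i)) i) /
       (pochhammer (a + c) k * pochhammer (b + d) n * fact n) =
       (-1) ^ k * of_nat (n choose k) * pochhammer S k *
       pochhammer (a + u) k * pochhammer (a - u) k *
       (pochhammer (a + b + of_nat k) (n - k) * pochhammer (a + d + of_nat k) (n - k)) /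
       (pochhammer (a + c) k * pochhammer (b + d) n * fact n)" by simp
  qed
  finally show ?thesis unfolding S_def by (simp add: mult_ac)
qed

text \<open>The prefactors of the polynomial absorb the denominators of the 4F3, because
  \<open>(z)_n / (z)_k = (z + k)_(n-k)\<close> when \<open>(z)_k\<close> is nonzero. The result
  matches the form of \<open>product_coeff_eq\<close> term by term.\<close>

lemma wilson_eq_sum:
  assumes "Re (a + b) > 0" "Re (a + c) > 0" "Re (a + d) > 0"
  shows "wilson n x a b c d =
    (\<Sum>k\<le>n. (-1) ^ k * of_nat (n choose k) * pochhammer (of_nat n + a + b + c + d - 1) k *
       pochhammer (a + \<i> * x) k * pochhammer (a - \<i> * x) k *
       pochhammer (a + b + of_nat k) (n - k) * pochhammer (a + c + of_nat k) (n - k) *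
       pochhammer (a + d + of_nat k) (n - k))"
proof -
  define S where "S = of_nat n + a + b + c + d - 1"
  define f where "f k = pochhammer (- of_nat n) k * pochhammer S k * pochhammer (a + \<i> * x) k *
      pochhammer (a - \<i> * x) k / (pochhammer (a + b) k * pochhammer (a + c) k * pochhammer (a + d) k) / fact k"
    for k
  have "hypergeom [- of_nat n, S, a + \<i> * x, a - \<i> * x] [a + b, a + c, a + d] 1 = (\<Sum>k. f k)"
    by (simp add: hypergeom_def f_def mult_ac)
  also have "\<dots> = (\<Sum>k\<le>n. f k)"
    by (rule suminf_finite) (auto simp: f_def pochhammer_of_nat_eq_0_iff)
  finally have "wilson n x a b c d = (\<Sum>k\<le>n. pochhammer (a + b) n * pochhammer (a + c) n * pochhammer (a + d) n * f k)"
    by (simp add: wilson_def S_def sum_distrib_left)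
  also have "\<dots> = (\<Sum>k\<le>n. (-1) ^ k * of_nat (n choose k) * pochhammer S k *
       pochhammer (a + \<i> * x) k * pochhammer (a - \<i> * x) k *
       pochhammer (a + b + of_nat k) (n - k) * pochhammer (a + c + of_nat k) (n - k) *
       pochhammer (a + d + of_nat k) (n - k))"
  proof (rule sum.cong, simp)
    fix k assume "k \<in> {..n}"
    then have k: "k \<le> n" by simp
    have "pochhammer z n / pochhammer z k = pochhammer (z + of_nat k) (n - k)" if "Re z > 0" for z
      using pochhammer_product[OF k, of z] pochhammer_nonzero[OF that, of k] by simp
    from this[OF assms(1)] this[OF assms(2)] this[OF assms(3)]
    have *: "pochhammer (a + b + of_nat k) (n - k) = pochhammer (a + b) n / pochhammer (a + b) k"
      "pochhammer (a + c + of_nat k) (n - k) = pochhammer (a + c) n / pochhammer (a + c) k"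
      "pochhammer (a + d + of_nat k) (n - k) = pochhammer (a + d) n / pochhammer (a + d) k"
      by simp_all
    have "(-1) ^ k * of_nat (n choose k) = (pochhammer (- of_nat n) k / fact k :: complex)"
      by (simp add: binomial_gbinomial gbinomial_pochhammer flip: power_mult_distrib)
    then show "pochhammer (a + b) n * pochhammer (a + c) n * pochhammer (a + d) n * f k =
      (-1) ^ k * of_nat (n choose k) * pochhammer S k *
       pochhammer (a + \<i> * x) k * pochhammer (a - \<i> * x) k *
       pochhammer (a + b + of_nat k) (n - k) * pochhammer (a + c + of_nat k) (n - k) *
       pochhammer (a + d + of_nat k) (n - k)"
      unfolding * f_def by (simp add: mult_ac)
  qed
  finally show ?thesis unfolding S_def .
qed

text \<open>The generating function of the Wilson polynomials, coefficientwise. With last parameter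
  \<open>h\<close> it serves to bound \<open>wilson k x a b c h\<close>.\<close>

lemma wilson_eq_product_coeff:
  assumes "Re (a + b) > 0" "Re (a + c) > 0" "Re (a + d) > 0" "Re (b + d) > 0"
  shows "wilson n x a b c d =
    pochhammer (a + c) n * pochhammer (b + d) n * fact n * product_coeff a b c d (\<i> * x) n"
  unfolding wilson_eq_sum[OF assms(1-3)] product_coeff_eq[OF assms(2,4)] sum_distrib_left
proof (rule sum.cong, simp)
  fix k assume "k \<in> {..n}"
  then have "pochhammer (a + c) n = pochhammer (a + c) k * pochhammer (a + c + of_nat k) (n - k)"
    by (simp add: pochhammer_product)
  with pochhammer_nonzero[OF assms(2), of k] pochhammer_nonzero[OF assms(4), of n]
  show "(-1) ^ k * of_nat (n choose k) * pochhammer (of_nat n + a + b + c + d - 1) k *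
       pochhammer (a + \<i> * x) k * pochhammer (a - \<i> * x) k *
       pochhammer (a + b + of_nat k) (n - k) * pochhammer (a + c + of_nat k) (n - k) *
       pochhammer (a + d + of_nat k) (n - k) =
    pochhammer (a + c) n * pochhammer (b + d) n * fact n *
    ((-1) ^ k * of_nat (n choose k) * pochhammer (of_nat n + a + b + c + d - 1) k *
       pochhammer (a + \<i> * x) k * pochhammer (a - \<i> * x) k *
       pochhammer (a + b + of_nat k) (n - k) * pochhammer (a + d + of_nat k) (n - k) /
       (pochhammer (a + c) k * pochhammer (b + d) n * fact n))"
    by simp
qed

text \<open>The factor of \<open>\<rho>\<^bsup>k+m\<^esup> W\<^sub>k\<close> on the right-hand side of the theorem, where
  \<open>(k + s - 1)\<^sub>k (2k + s - 1)\<^sub>m / (k + s - 1)\<^sub>m\<close>, \<open>s = a + b + c + d\<close>, is contracted to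
  \<open>(k + m + s - 1)\<^sub>k\<close>; this form also covers the exceptional case \<open>k = 0\<close>, \<open>s = 1\<close>.\<close>

definition connection_coeff ::
  "complex \<Rightarrow> complex \<Rightarrow> complex \<Rightarrow> complex \<Rightarrow> complex \<Rightarrow> nat \<Rightarrow> nat \<Rightarrow> complex" where
  "connection_coeff a b c d h k m =
     pochhammer (of_nat (k + m) + a + b + c + d - 1) k * pochhammer (d - h) m *
     pochhammer (of_nat k + a + b) m * pochhammer (of_nat k + b + c) m /
     (pochhammer (of_nat k + a + b + c + h - 1) k * pochhammer (of_nat (2 * k) + a + b + c + h) m *
      pochhammer (a + c) k * pochhammer (b + d) (k + m) * fact k * fact m)"

text \<open>The coefficients of \<open>(a + ix)_j (a - ix)_j\<close> are compared. With
  \<open>k = j + i\<close> and \<open>M = n - j\<close>, the sum over \<open>i\<close> is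
  \<open>well_poised_sum\<close> for \<open>B = a + h + j\<close>, \<open>D = b + c + j\<close> and
  \<open>e = d - h\<close>, with value \<open>(a + d + j)_M\<close>.\<close>

lemma product_coeff_connection:
  assumes pos: "Re a > 0" "Re b > 0" "Re c > 0" "Re d > 0" "Re h > 0"
  shows "product_coeff a b c d (\<i> * x) n =
    (\<Sum>k\<le>n. connection_coeff a b c d h k (n - k) * wilson k x a b c h)"
proof -
  have pos2: "Re (a + b) > 0" "Re (a + c) > 0" "Re (a + h) > 0" "Re (b + d) > 0"
    using pos by simp_all
  define w where "w k j = (-1) ^ j * of_nat (k choose j) * pochhammer (of_nat k + a + b + c + h - 1) j *
       pochhammer (a + \<i> * x) j * pochhammer (a - \<i> * x) j *
       pochhammer (a + b + of_nat j) (k - j) * pochhammer (a + c + of_nat j) (k - j) *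
       pochhammer (a + h + of_nat j) (k - j)" for k j
  have "(\<Sum>k\<le>n. connection_coeff a b c d h k (n - k) * wilson k x a b c h) =
     (\<Sum>k\<le>n. \<Sum>j\<le>k. connection_coeff a b c d h k (n - k) * w k j)"
    unfolding wilson_eq_sum[OF pos2(1-3)] w_def by (simp add: sum_distrib_left)
  also have "\<dots> = (\<Sum>j\<le>n. \<Sum>i\<le>n - j. connection_coeff a b c d h (j + i) (n - (j + i)) * w (j + i) j)"
    by (rule sum_triangle_shift)
  also have "\<dots> = product_coeff a b c d (\<i> * x) n"
    unfolding product_coeff_eq[OF pos2(2,4)]
  proof (rule sum.cong, simp)
    fix j assume "j \<in> {..n}"
    then have j: "j \<le> n" by simp
    define M where "M = n - j"
    have n: "n = j + M" using j by (simp add: M_def)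
    define A where "A = of_nat (2 * j) + a + b + c + h - 1"
    define P where "P = (-1) ^ j * pochhammer (a + \<i> * x) j * pochhammer (a - \<i> * x) j *
      pochhammer (a + b + of_nat j) M * pochhammer (of_nat n + a + b + c + d - 1) j /
      (pochhammer (a + c) j * pochhammer (b + d) n * fact j * fact M)"
    have "connection_coeff a b c d h (j + i) (n - (j + i)) * w (j + i) j =
      P * (of_nat (M choose i) * pochhammer (d - h) (M - i) * pochhammer (A + of_nat M + (d - h)) i *
            pochhammer (a + h + of_nat j) i * pochhammer (b + c + of_nat j + of_nat i) (M - i) /
            (pochhammer (A + of_nat i) i * pochhammer (A + of_nat (2 * i) + 1) (M - i)))"
      if i: "i \<le> M" for i
    proof -
      define k where "k = j + i"
      have nk: "n - k = M - i" "k + (M - i) = n" "k - j = i" using i by (simp_all add: k_def n)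
      define s where "s = a + b + c + h"
      have s: "Re s > 0" using pos by (simp add: s_def)
      have e1: "pochhammer (of_nat n + a + b + c + d - 1) k =
          pochhammer (of_nat n + a + b + c + d - 1) j * pochhammer (A + of_nat M + (d - h)) i"
        unfolding k_def pochhammer_product' by (simp add: A_def n algebra_simps)
      have e2: "pochhammer (of_nat k + a + b + c + h - 1) k =
          pochhammer (of_nat k + a + b + c + h - 1) j * pochhammer (A + of_nat i) i"
        unfolding k_def pochhammer_product' by (simp add: A_def algebra_simps)
      have e3: "of_nat (2 * k) + a + b + c + h = A + of_nat (2 * i) + 1"
        by (simp add: A_def k_def algebra_simps)
      have e4: "pochhammer (a + b + of_nat j) M = pochhammer (a + b + of_nat j) i * pochhammer (of_nat k + a + b) (M - i)"
        using pochhammer_product[OF i, of "a + b + of_nat j"] by (simp add: k_def add_ac)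
      have e5: "pochhammer (a + c) k = pochhammer (a + c) j * pochhammer (a + c + of_nat j) i"
        unfolding k_def pochhammer_product' by simp
      have e6: "of_nat k + b + c = b + c + of_nat j + of_nat i" by (simp add: k_def)
      have e7: "of_nat (k choose j) / (fact k * fact (M - i)) = (of_nat (M choose i) / (fact j * fact M) :: complex)"
        using i by (simp add: k_def binomial_fact)
      \<comment> \<open>The base can vanish only for \<open>k = 0\<close>, namely when
        \<open>a + b + c + h = 1\<close>; then \<open>j = 0\<close> and the product is empty. For
        \<open>j > 0\<close> also \<open>k \<ge> 1\<close>, and the real part is positive.\<close>
      have n1: "pochhammer (of_nat k + a + b + c + h - 1) j \<noteq> 0"
      proof (cases "j = 0")
        case False
        then have "Re (of_nat k + a + b + c + h - 1) > 0"
          using s by (simp add: k_def s_def)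
        then show ?thesis by (rule pochhammer_nonzero)
      qed simp
      have n2: "pochhammer (a + c + of_nat j) i \<noteq> 0"
        by (rule pochhammer_nonzero) (use pos in simp)
      have "connection_coeff a b c d h k (n - k) * w k j =
        (-1) ^ j * pochhammer (a + \<i> * x) j * pochhammer (a - \<i> * x) j *
        (pochhammer (a + b + of_nat j) i * pochhammer (of_nat k + a + b) (M - i)) *
        pochhammer (of_nat n + a + b + c + d - 1) j / (pochhammer (a + c) j * pochhammer (b + d) n) *
        (pochhammer (d - h) (M - i) * pochhammer (A + of_nat M + (d - h)) i *
            pochhammer (a + h + of_nat j) i * pochhammer (b + c + of_nat j + of_nat i) (M - i) /
            (pochhammer (A + of_nat i) i * pochhammer (A + of_nat (2 * i) + 1) (M - i))) *
        (of_nat (k choose j) / (fact k * fact (M - i)))"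
        unfolding connection_coeff_def w_def nk e1 e2 e3 e5 e6 using n1 n2 by (simp add: mult_ac)
      also have "\<dots> = P * (of_nat (M choose i) * pochhammer (d - h) (M - i) * pochhammer (A + of_nat M + (d - h)) i *
            pochhammer (a + h + of_nat j) i * pochhammer (b + c + of_nat j + of_nat i) (M - i) /
            (pochhammer (A + of_nat i) i * pochhammer (A + of_nat (2 * i) + 1) (M - i)))"
        unfolding e7 e4[symmetric] P_def by (simp add: mult_ac)
      finally show ?thesis unfolding k_def .
    qed
    then have "(\<Sum>i\<le>n - j. connection_coeff a b c d h (j + i) (n - (j + i)) * w (j + i) j) =
      P * (\<Sum>i\<le>M. of_nat (M choose i) * pochhammer (d - h) (M - i) * pochhammer (A + of_nat M + (d - h)) i *
            pochhammer (a + h + of_nat j) i * pochhammer (b + c + of_nat j + of_nat i) (M - i) /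
            (pochhammer (A + of_nat i) i * pochhammer (A + of_nat (2 * i) + 1) (M - i)))"
      unfolding M_def[symmetric] sum_distrib_left by (intro sum.cong) auto
    also have "\<dots> = P * pochhammer (a + h + of_nat j + (d - h)) M"
    proof (subst well_poised_sum)
      show "A = a + h + of_nat j + (b + c + of_nat j) - 1" by (simp add: A_def)
      fix k
      have "Re (A + of_nat (Suc k)) > 0" using pos by (simp add: A_def)
      then show "A + of_nat (Suc k) \<noteq> 0" by (metis less_irrefl zero_complex.sel(1))
    qed simp
    also have "a + h + of_nat j + (d - h) = a + d + of_nat j" by simp
    finally show "(\<Sum>i\<le>n - j. connection_coeff a b c d h (j + i) (n - (j + i)) * w (j + i) j) =
      (-1) ^ j * of_nat (n choose j) * pochhammer (of_nat n + a + b + c + d - 1) j *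
       pochhammer (a + \<i> * x) j * pochhammer (a - \<i> * x) j *
       pochhammer (a + b + of_nat j) (n - j) * pochhammer (a + d + of_nat j) (n - j) /
       (pochhammer (a + c) j * pochhammer (b + d) n * fact n)"
      unfolding P_def M_def binomial_fact[OF j] by (simp add: mult_ac)
  qed
  finally show ?thesis by simp
qed

section \<open>Growth bounds and absolute convergence\<close>

text \<open>The quotient is a product of \<open>m\<close> consecutive values \<open>f j\<close>, and
  these tend to 1. Only the indices below some \<open>J\<close> can violate \<open>f j < R\<close>;
  together they cost at most the factor \<open>K ^ J\<close>, whatever the starting index
  \<open>k\<close>.\<close>

lemma pochhammer_ratio_bound:
  fixes \<alpha> \<beta> :: complex
  assumes R: "R > 1"
  obtains C where "C > 0"
    "\<And>k m. norm (pochhammer (of_nat k + \<alpha>) m / pochhammer (of_nat k + \<beta>) m) \<le> C * R ^ m"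
proof -
  define f where "f j = norm ((\<alpha> + of_nat j) / (\<beta> + of_nat j))" for j :: nat
  have inf: "filterlim (\<lambda>j. \<beta> + of_nat j) at_infinity sequentially"
    by (intro tendsto_add_filterlim_at_infinity[OF tendsto_const] tendsto_of_nat)
  have "(\<lambda>j. 1 + (\<alpha> - \<beta>) / (\<beta> + of_nat j)) \<longlonglongrightarrow> 1 + 0"
    by (intro tendsto_intros tendsto_divide_0[OF tendsto_const inf])
  moreover have "eventually (\<lambda>j. 1 + (\<alpha> - \<beta>) / (\<beta> + of_nat j) = (\<alpha> + of_nat j) / (\<beta> + of_nat j)) sequentially"
    using filterlim_at_infinity_imp_eventually_ne[OF inf, of 0]
    by eventually_elim (simp add: field_simps)
  ultimately have "(\<lambda>j. (\<alpha> + of_nat j) / (\<beta> + of_nat j)) \<longlonglongrightarrow> 1"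
    by (simp add: tendsto_cong)
  then have "f \<longlonglongrightarrow> 1"
    unfolding f_def using tendsto_norm by fastforce
  then have "eventually (\<lambda>j. f j < R) sequentially"
    using R by (simp add: order_tendstoD(2))
  then obtain J where J: "\<And>j. j \<ge> J \<Longrightarrow> f j < R"
    unfolding eventually_sequentially by blast
  \<comment> \<open>\<open>K\<close> dominates every \<open>f j\<close> with \<open>j < J\<close>.
    The summand 1 ensures \<open>K \<ge> 1\<close>, so that the exponent can later be raised to
    \<open>J\<close>.\<close>
  define K where "K = 1 + (\<Sum>j<J. f j)"
  have f0: "f j \<ge> 0" for j by (simp add: f_def)
  have K1: "K \<ge> 1" unfolding K_def using f0 by (simp add: sum_nonneg)
  define g where "g j = (if j < J then K else 1)" for j :: nat
  have fg: "f j \<le> g j * R" for j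
  proof (cases "j < J")
    case True
    then have "f j \<le> K" unfolding K_def
      using member_le_sum[of j "{..<J}" f] f0 by simp
    also have "K \<le> K * R" using K1 R by simp
    finally show ?thesis using True by (simp add: g_def)
  next
    case False
    then show ?thesis using J[of j] by (simp add: g_def)
  qed
  have "norm (pochhammer (of_nat k + \<alpha>) m / pochhammer (of_nat k + \<beta>) m) \<le> K ^ J * R ^ m" for k m
  proof -
    \<comment> \<open>If some \<open>\<beta> + j\<close> in the range is zero, both sides are 0 by
      the convention \<open>x / 0 = 0\<close>.\<close>
    have "norm (pochhammer (of_nat k + \<alpha>) m / pochhammer (of_nat k + \<beta>) m) = (\<Prod>i<m. f (k + i))"
      by (simp add: pochhammer_prod prod_dividef[symmetric] norm_divide f_def atLeast0LessThan add_ac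
          flip: prod_norm)
    also have "\<dots> \<le> (\<Prod>i<m. g (k + i) * R)"
      by (intro prod_mono) (simp add: f0 fg)
    also have "\<dots> = (\<Prod>i<m. g (k + i)) * R ^ m"
      by (simp add: prod.distrib)
    also have "(\<Prod>i<m. g (k + i)) = K ^ card {i. i < m \<and> k + i < J}"
      by (simp add: g_def prod.If_cases lessThan_def Collect_conj_eq)
    also have "\<dots> \<le> K ^ J"
    proof (intro power_increasing K1)
      have "card {i. i < m \<and> k + i < J} \<le> card {..<J}"
        by (intro card_mono) auto
      then show "card {i. i < m \<and> k + i < J} \<le> J" by simp
    qed
    finally show ?thesis using R by simp
  qed
  moreover have "K ^ J > 0" using K1 by simp
  ultimately show ?thesis using that by blast
qed

text \<open>With \<open>fact n\<close> read as \<open>pochhammer 1 n\<close>, each term is a product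
  of two ratios of equal length. A geometric series of ratio \<open>R^2 |z|\<close> dominates once
  \<open>R > 1\<close> is close enough to 1.\<close>

lemma summable_hypergeom_2F1:
  fixes p q r z :: complex
  assumes z: "norm z < 1"
  shows "summable (\<lambda>n. norm (pochhammer p n * pochhammer q n / (pochhammer r n * fact n) * z ^ n))"
proof -
  have "((\<lambda>R. R\<^sup>2 * norm z) \<longlongrightarrow> 1\<^sup>2 * norm z) (at_right (1::real))"
    by (intro tendsto_intros)
  then have "eventually (\<lambda>R. R\<^sup>2 * norm z < 1) (at_right (1::real))"
    using z by (intro order_tendstoD(2)) auto
  then have "eventually (\<lambda>R. R > 1 \<and> R\<^sup>2 * norm z < 1) (at_right (1::real))"
    using eventually_at_right_less[of 1] by eventually_elim simp
  then obtain R :: real where R: "R > 1" "R\<^sup>2 * norm z < 1"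
    using eventually_happens'[OF trivial_limit_at_right_real] by blast
  obtain C1 where C1: "C1 > 0"
    "\<And>k m. norm (pochhammer (of_nat k + p) m / pochhammer (of_nat k + r) m) \<le> C1 * R ^ m"
    using pochhammer_ratio_bound[OF R(1)] by blast
  obtain C2 where C2: "C2 > 0"
    "\<And>k m. norm (pochhammer (of_nat k + q) m / pochhammer (of_nat k + 1) m) \<le> C2 * R ^ m"
    using pochhammer_ratio_bound[OF R(1)] by blast
  have bound: "norm (pochhammer p n * pochhammer q n / (pochhammer r n * fact n) * z ^ n) \<le>
      C1 * C2 * (R\<^sup>2 * norm z) ^ n" for n
  proof -
    have "norm (pochhammer p n * pochhammer q n / (pochhammer r n * fact n) * z ^ n) =
      norm (pochhammer p n / pochhammer r n) * norm (pochhammer q n / pochhammer 1 n) * norm z ^ n"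
      by (simp add: norm_mult norm_divide norm_power pochhammer_fact)
    also have "\<dots> \<le> (C1 * R ^ n) * (C2 * R ^ n) * norm z ^ n"
      using C1(2)[of 0 n] C2(2)[of 0 n] by (intro mult_right_mono mult_mono') auto
    also have "\<dots> = C1 * C2 * (R\<^sup>2 * norm z) ^ n"
      by (simp add: power_mult_distrib power2_eq_square mult_ac)
    finally show ?thesis .
  qed
  have "summable (\<lambda>n. C1 * C2 * (R\<^sup>2 * norm z) ^ n)"
    using R by (intro summable_mult summable_geometric) simp
  then show ?thesis
    by (rule summable_comparison_test') (use bound in simp)
qed

lemma product_coeff_times_power:
  "product_coeff a b c d u n * z ^ n = (\<Sum>j\<le>n.
     (pochhammer (a + u) j * pochhammer (c + u) j / (pochhammer (a + c) j * fact j) * z ^ j) *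
     (pochhammer (b - u) (n - j) * pochhammer (d - u) (n - j) / (pochhammer (b + d) (n - j) * fact (n - j)) * z ^ (n - j)))"
  unfolding product_coeff_def sum_distrib_right
proof (rule sum.cong, simp)
  fix j assume "j \<in> {..n}"
  then have "z ^ n = z ^ j * z ^ (n - j)" by (simp flip: power_add)
  then show "pochhammer (a + u) j * pochhammer (c + u) j / (pochhammer (a + c) j * fact j) *
     (pochhammer (b - u) (n - j) * pochhammer (d - u) (n - j) / (pochhammer (b + d) (n - j) * fact (n - j))) * z ^ n =
     (pochhammer (a + u) j * pochhammer (c + u) j / (pochhammer (a + c) j * fact j) * z ^ j) *
     (pochhammer (b - u) (n - j) * pochhammer (d - u) (n - j) / (pochhammer (b + d) (n - j) * fact (n - j)) * z ^ (n - j))"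
    by simp
qed

lemma product_coeff_sums:
  assumes "norm z < 1"
  shows "(\<lambda>n. product_coeff a b c d u n * z ^ n) sums
     (hypergeom [a + u, c + u] [a + c] z * hypergeom [b - u, d - u] [b + d] z)"
  using Cauchy_product_sums[OF summable_hypergeom_2F1[OF assms] summable_hypergeom_2F1[OF assms]]
  unfolding product_coeff_times_power hypergeom_def by simp

text \<open>The norms are dominated by the Cauchy product of two series that converge absolutely at
  the point \<open>q\<close>. The use below is for a \<open>q < 1\<close> that may exceed
  \<open>norm \<rho>\<close>, which leaves room for the growth of the connection
  coefficients.\<close>

lemma product_coeff_abs_summable:
  assumes q: "0 \<le> q" "q < 1"
  shows "summable (\<lambda>n. norm (product_coeff a b c d u n) * q ^ n)"
proof -
  have z: "norm (of_real q :: complex) < 1" using q by simp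
  show ?thesis
  proof (rule summable_comparison_test')
    show "summable (\<lambda>n. \<Sum>j\<le>n.
       norm (pochhammer (a + u) j * pochhammer (c + u) j / (pochhammer (a + c) j * fact j) * of_real q ^ j) *
       norm (pochhammer (b - u) (n - j) * pochhammer (d - u) (n - j) / (pochhammer (b + d) (n - j) * fact (n - j)) * of_real q ^ (n - j)))"
      by (rule summable_Cauchy_product) (use summable_hypergeom_2F1[OF z] in simp_all)
    fix n
    have "norm (norm (product_coeff a b c d u n) * q ^ n) = norm (product_coeff a b c d u n * of_real q ^ n)"
      using q by (simp add: norm_mult norm_power)
    also have "\<dots> \<le> (\<Sum>j\<le>n.
       norm (pochhammer (a + u) j * pochhammer (c + u) j / (pochhammer (a + c) j * fact j) * of_real q ^ j) *
       norm (pochhammer (b - u) (n - j) * pochhammer (d - u) (n - j) / (pochhammer (b + d) (n - j) * fact (n - j)) * of_real q ^ (n - j)))"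
      unfolding product_coeff_times_power norm_mult[symmetric] by (rule norm_sum)
    finally show "norm (norm (product_coeff a b c d u n) * q ^ n) \<le> (\<Sum>j\<le>n.
       norm (pochhammer (a + u) j * pochhammer (c + u) j / (pochhammer (a + c) j * fact j) * of_real q ^ j) *
       norm (pochhammer (b - u) (n - j) * pochhammer (d - u) (n - j) / (pochhammer (b + d) (n - j) * fact (n - j)) * of_real q ^ (n - j)))" .
  qed
qed

text \<open>Expressing \<open>wilson\<close> through \<open>product_coeff\<close> cancels
  \<open>(a + c)_k\<close> and \<open>k!\<close>. The rest is arranged into seven ratios of
  Pochhammer symbols of equal length, three of length \<open>k\<close> and four of length
  \<open>m\<close>, whence the exponents \<open>3 * k\<close> and \<open>4 * m\<close>.\<close>

lemma connection_coeff_wilson_bound: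
  assumes R: "R > 1" and pos: "Re a > 0" "Re b > 0" "Re c > 0" "Re d > 0" "Re h > 0"
  obtains C where "C > 0"
    "\<And>k m. norm (connection_coeff a b c d h k m * wilson k x a b c h) \<le>
       C * (norm (product_coeff a b c h (\<i> * x) k) * R ^ (3 * k) * R ^ (4 * m))"
proof -
  define s s' where "s = a + b + c + d" and "s' = a + b + c + h"
  obtain C1 where C1: "C1 > 0"
    "\<And>k m. norm (pochhammer (of_nat k + (s - 1)) m / pochhammer (of_nat k + s) m) \<le> C1 * R ^ m"
    using pochhammer_ratio_bound[OF R(1)] by blast
  obtain C2 where C2: "C2 > 0"
    "\<And>k m. norm (pochhammer (of_nat k + s) m / pochhammer (of_nat k + (s' - 1)) m) \<le> C2 * R ^ m"
    using pochhammer_ratio_bound[OF R(1)] by blast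
  obtain C3 where C3: "C3 > 0"
    "\<And>k m. norm (pochhammer (of_nat k + s) m / pochhammer (of_nat k + s') m) \<le> C3 * R ^ m"
    using pochhammer_ratio_bound[OF R(1)] by blast
  obtain C4 where C4: "C4 > 0"
    "\<And>k m. norm (pochhammer (of_nat k + (a + b)) m / pochhammer (of_nat k + s) m) \<le> C4 * R ^ m"
    using pochhammer_ratio_bound[OF R(1)] by blast
  obtain C5 where C5: "C5 > 0"
    "\<And>k m. norm (pochhammer (of_nat k + (b + c)) m / pochhammer (of_nat k + (b + d)) m) \<le> C5 * R ^ m"
    using pochhammer_ratio_bound[OF R(1)] by blast
  obtain C6 where C6: "C6 > 0"
    "\<And>k m. norm (pochhammer (of_nat k + (d - h)) m / pochhammer (of_nat k + 1) m) \<le> C6 * R ^ m"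
    using pochhammer_ratio_bound[OF R(1)] by blast
  obtain C7 where C7: "C7 > 0"
    "\<And>k m. norm (pochhammer (of_nat k + (b + h)) m / pochhammer (of_nat k + (b + d)) m) \<le> C7 * R ^ m"
    using pochhammer_ratio_bound[OF R(1)] by blast
  have "norm (connection_coeff a b c d h k m * wilson k x a b c h) \<le>
       C1 * C2 * C3 * C4 * C5 * C6 * C7 * (norm (product_coeff a b c h (\<i> * x) k) * R ^ (3 * k) * R ^ (4 * m))" for k m
  proof -
    have sn: "pochhammer (of_nat k + s) m \<noteq> 0" "pochhammer (of_nat (k + m) + s) k \<noteq> 0"
      "pochhammer (a + c) k \<noteq> 0"
      using pos by (auto intro!: pochhammer_nonzero simp: s_def)
    \<comment> \<open>Both sides are \<open>pochhammer (of_nat k + s) (k + m)\<close>, split after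
      \<open>m\<close> and after \<open>k\<close> factors.\<close>
    have ss: "pochhammer (of_nat k + s) m * pochhammer (of_nat (k + m) + s) k =
      pochhammer (of_nat k + s) k * pochhammer (of_nat (2 * k) + s) m"
      using pochhammer_product'[of "of_nat k + s" m k] pochhammer_product'[of "of_nat k + s" k m]
      by (simp add: add_ac)
    have bd: "pochhammer (b + d) (k + m) = pochhammer (b + d) k * pochhammer (of_nat k + (b + d)) m"
      by (simp add: pochhammer_product' add_ac)
    have "connection_coeff a b c d h k m * wilson k x a b c h =
      product_coeff a b c h (\<i> * x) k * (pochhammer (of_nat (k + m) + (s - 1)) k *
        pochhammer (d - h) m * pochhammer (of_nat k + (a + b)) m * pochhammer (of_nat k + (b + c)) m *
        pochhammer (b + h) k /
        (pochhammer (of_nat k + (s' - 1)) k * pochhammer (of_nat (2 * k) + s') m *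
         pochhammer (b + d) k * pochhammer (of_nat k + (b + d)) m * pochhammer 1 m))"
      using pos sn(3)
      by (simp add: wilson_eq_product_coeff connection_coeff_def s_def s'_def bd pochhammer_fact[symmetric] algebra_simps)
    \<comment> \<open>\<open>(k + m + s - 1)\<^sub>k\<close> and \<open>(k + s' - 1)\<^sub>k\<close> start at different indices, so the fraction \<open>ss\<close>,
       which equals 1, is inserted.\<close>
    also have "\<dots> = product_coeff a b c h (\<i> * x) k * (pochhammer (of_nat (k + m) + (s - 1)) k *
        pochhammer (d - h) m * pochhammer (of_nat k + (a + b)) m * pochhammer (of_nat k + (b + c)) m *
        pochhammer (b + h) k /
        (pochhammer (of_nat k + (s' - 1)) k * pochhammer (of_nat (2 * k) + s') m *
         pochhammer (b + d) k * pochhammer (of_nat k + (b + d)) m * pochhammer 1 m)) *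
       ((pochhammer (of_nat k + s) k * pochhammer (of_nat (2 * k) + s) m) /
        (pochhammer (of_nat k + s) m * pochhammer (of_nat (k + m) + s) k))"
      unfolding ss[symmetric] using sn by simp
    also have "\<dots> = product_coeff a b c h (\<i> * x) k *
       ((pochhammer (of_nat (k + m) + (s - 1)) k / pochhammer (of_nat (k + m) + s) k) *
        (pochhammer (of_nat k + s) k / pochhammer (of_nat k + (s' - 1)) k) *
        (pochhammer (of_nat (2 * k) + s) m / pochhammer (of_nat (2 * k) + s') m) *
        (pochhammer (of_nat k + (a + b)) m / pochhammer (of_nat k + s) m) *
        (pochhammer (of_nat k + (b + c)) m / pochhammer (of_nat k + (b + d)) m) *
        (pochhammer (d - h) m / pochhammer 1 m) *
        (pochhammer (b + h) k / pochhammer (b + d) k))"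
      by (simp add: mult_ac)
    also have "norm \<dots> \<le> norm (product_coeff a b c h (\<i> * x) k) *
       ((C1 * R ^ k) * (C2 * R ^ k) * (C3 * R ^ m) * (C4 * R ^ m) * (C5 * R ^ m) * (C6 * R ^ m) * (C7 * R ^ k))"
      unfolding norm_mult
      using C1(2)[of "k + m" k] C2(2)[of k k] C3(2)[of "2 * k" m] C4(2)[of k m] C5(2)[of k m]
        C6(2)[of 0 m] C7(2)[of 0 k]
      by (intro mult_left_mono mult_mono') auto
    also have "\<dots> = C1 * C2 * C3 * C4 * C5 * C6 * C7 * (norm (product_coeff a b c h (\<i> * x) k) * R ^ (3 * k) * R ^ (4 * m))"
      by (simp add: power_mult power3_eq_cube power4_eq_xxxx power_mult_distrib mult_ac)
    finally show ?thesis .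
  qed
  moreover have "C1 * C2 * C3 * C4 * C5 * C6 * C7 > 0"
    using C1 C2 C3 C4 C5 C6 C7 by simp
  ultimately show ?thesis using that by blast
qed

lemma connection_summable:
  assumes \<rho>: "norm \<rho> < 1" and pos: "Re a > 0" "Re b > 0" "Re c > 0" "Re d > 0" "Re h > 0"
  shows "(\<lambda>(k, m). connection_coeff a b c d h k m * wilson k x a b c h * \<rho> ^ (k + m)) summable_on UNIV"
proof -
  have "((\<lambda>R. R ^ 4 * norm \<rho>) \<longlongrightarrow> 1 ^ 4 * norm \<rho>) (at_right (1::real))"
    by (intro tendsto_intros)
  then have "eventually (\<lambda>R. R ^ 4 * norm \<rho> < 1) (at_right (1::real))"
    using \<rho> by (intro order_tendstoD(2)) auto
  then have "eventually (\<lambda>R. R > 1 \<and> R ^ 4 * norm \<rho> < 1) (at_right (1::real))"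
    using eventually_at_right_less[of 1] by eventually_elim simp
  then obtain R :: real where R: "R > 1" "R ^ 4 * norm \<rho> < 1"
    using eventually_happens'[OF trivial_limit_at_right_real] by blast
  define q where "q = R ^ 4 * norm \<rho>"
  have q: "0 \<le> q" "q < 1" using R by (simp_all add: q_def)
  obtain C where C: "C > 0" "\<And>k m. norm (connection_coeff a b c d h k m * wilson k x a b c h) \<le>
       C * (norm (product_coeff a b c h (\<i> * x) k) * R ^ (3 * k) * R ^ (4 * m))"
    using connection_coeff_wilson_bound[OF R(1) pos] by blast
  let ?P = "\<lambda>k. norm (product_coeff a b c h (\<i> * x) k) * q ^ k"
  have P: "?P summable_on UNIV"
    using product_coeff_abs_summable[OF q] q by (subst summable_on_UNIV_nonneg_real_iff) auto
  have G: "(\<lambda>m. q ^ m) summable_on UNIV"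
    using q by (subst summable_on_UNIV_nonneg_real_iff) auto
  have "(\<lambda>y. norm (case y of (k, m) \<Rightarrow> ?P k * q ^ m)) summable_on UNIV \<times> UNIV"
    unfolding Infinite_Sum.abs_summable_on_Sigma_iff
  proof (intro conjI ballI)
    show "(\<lambda>m. norm (case (k, m) of (k, m) \<Rightarrow> ?P k * q ^ m)) summable_on UNIV" for k
      using summable_on_cmult_right[OF G, of "?P k"] q by (simp add: abs_mult)
    show "(\<lambda>k. norm (\<Sum>\<^sub>\<infinity>m. norm (case (k, m) of (k, m) \<Rightarrow> ?P k * q ^ m))) summable_on UNIV"
      using summable_on_cmult_left[OF P, of "infsum (\<lambda>m. q ^ m) UNIV"] q
      by (simp add: abs_mult infsum_cmult_right' infsum_nonneg)
  qed
  then have "(\<lambda>(k, m). C * (?P k * q ^ m)) summable_on UNIV"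
    using summable_on_cmult_right[OF Infinite_Sum.abs_summable_summable, of "\<lambda>(k, m). ?P k * q ^ m" UNIV C]
    by (simp add: case_prod_unfold)
  then have "(\<lambda>y. norm (case y of (k, m) \<Rightarrow>
      connection_coeff a b c d h k m * wilson k x a b c h * \<rho> ^ (k + m))) summable_on UNIV"
  proof (rule Infinite_Sum.abs_summable_on_comparison_test')
    fix y :: "nat \<times> nat"
    obtain k m where y: "y = (k, m)" by force
    have "norm (connection_coeff a b c d h k m * wilson k x a b c h * \<rho> ^ (k + m)) \<le>
       C * (norm (product_coeff a b c h (\<i> * x) k) * R ^ (3 * k) * R ^ (4 * m)) * norm \<rho> ^ (k + m)"
      unfolding norm_mult[of _ "\<rho> ^ _"] norm_power by (intro mult_right_mono C(2)) simp
    \<comment> \<open>The exponent \<open>3 * k\<close> is raised to \<open>4 * k\<close>, so that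
      the same \<open>q = R ^ 4 * norm \<rho>\<close> serves both indices.\<close>
    also have "\<dots> \<le> C * (norm (product_coeff a b c h (\<i> * x) k) * R ^ (4 * k) * R ^ (4 * m)) * norm \<rho> ^ (k + m)"
      using C(1) R by (intro mult_right_mono mult_left_mono power_increasing) auto
    also have "\<dots> = C * (?P k * q ^ m)"
      unfolding q_def power_mult[of R 4] power_add power_mult_distrib by (simp only: mult_ac)
    finally show "norm (case y of (k, m) \<Rightarrow> connection_coeff a b c d h k m * wilson k x a b c h * \<rho> ^ (k + m)) \<le>
       (case y of (k, m) \<Rightarrow> C * (?P k * q ^ m))"
      by (simp add: y)
  qed
  then show ?thesis by (rule Infinite_Sum.abs_summable_summable)
qed

section \<open>Rearrangement of the double series\<close>

text \<open>For \<open>k = 0\<close> the upper parameter \<open>2k + a + b + c + d - 1\<close> and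
  the lower parameter \<open>k + a + b + c + d - 1\<close> of the 4F3 coincide and cancel. If their
  common value is 0, the series as encoded would lose all terms after the first, so this one case is
  stated with the 3F2 left by the cancellation.\<close>

theorem theorem2p1:
  fixes \<rho> a b c d h :: complex and x :: real
  assumes "norm \<rho> < 1"
    and "x > 0"
    and "Re a > 0" "Re b > 0" "Re c > 0" "Re d > 0" "Re h > 0"
    and "conj_pairs {#a, b, c, d#}"
    and "conj_pairs {#a, b, c, h#}"
  shows "(\<lambda>k. pochhammer (of_nat k + a + b + c + d - 1) k /
            (pochhammer (of_nat k + a + b + c + h - 1) k *
             pochhammer (a + c) k * pochhammer (b + d) k * fact k) *
          (if k = 0 \<and> a + b + c + d = 1
           then hypergeom
                  [d - h, a + b, b + c]
                  [a + b + c + h, b + d] \<rho>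
           else hypergeom
                  [d - h, of_nat (2 * k) + a + b + c + d - 1, of_nat k + a + b, of_nat k + b + c]
                  [of_nat k + a + b + c + d - 1, of_nat (2 * k) + a + b + c + h, of_nat k + b + d] \<rho>) *
          \<rho> ^ k * wilson k (of_real x) a b c h)
         sums
         (hypergeom [a + \<i> * of_real x, c + \<i> * of_real x] [a + c] \<rho> *
          hypergeom [b - \<i> * of_real x, d - \<i> * of_real x] [b + d] \<rho>)"
    (is "?term sums ?prod")
proof -
  note pos = assms(3-7)
  define u :: complex where "u = \<i> * of_real x"
  define f where "f = (\<lambda>(k, m). connection_coeff a b c d h k m * wilson k (of_real x) a b c h * \<rho> ^ (k + m))"
  have f: "f summable_on UNIV"
    unfolding f_def by (rule connection_summable[OF assms(1) pos])
  define S where "S = infsum f UNIV"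
  have fS: "(f has_sum S) UNIV"
    unfolding S_def using f by (rule has_sum_infsum)
  \<comment> \<open>Summation along the diagonals \<open>n = k + m\<close> yields the power series
    of the product of the two 2F1; summation along the rows of fixed \<open>k\<close>, further
    below, yields the series of the theorem.\<close>
  have "(f has_sum S) (UNIV \<times> UNIV) \<longleftrightarrow> ((\<lambda>(n, k). f (k, n - k)) has_sum S) (SIGMA n:UNIV. {..n})"
    by (rule has_sum_reindex_bij_witness[where i = "\<lambda>(n, k). (k, n - k)" and j = "\<lambda>(k, m). (k + m, k)"]) auto
  with fS have "((\<lambda>(n, k). f (k, n - k)) has_sum S) (SIGMA n:UNIV. {..n})" by simp
  then have "((\<lambda>n. \<Sum>k\<le>n. f (k, n - k)) has_sum S) UNIV"
    by (rule has_sum_SigmaD) (simp add: has_sum_finite)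
  moreover have "(\<Sum>k\<le>n. f (k, n - k)) = product_coeff a b c d u n * \<rho> ^ n" for n
    unfolding u_def product_coeff_connection[OF pos] by (simp add: f_def sum_distrib_right)
  ultimately have "(\<lambda>n. product_coeff a b c d u n * \<rho> ^ n) sums S"
    using has_sum_imp_sums by simp
  from sums_unique2[OF this product_coeff_sums[OF assms(1)]] have S: "S = ?prod"
    unfolding u_def .
  have "(?term has_sum S) UNIV"
  proof (rule has_sum_SigmaD[where f = f and B = "\<lambda>_. UNIV"])
    show "(f has_sum S) (UNIV \<times> UNIV)" using fS by simp
    fix k
    define T where "T = pochhammer (of_nat k + a + b + c + d - 1) k /
            (pochhammer (of_nat k + a + b + c + h - 1) k *
             pochhammer (a + c) k * pochhammer (b + d) k * fact k)"
    define W where "W = \<rho> ^ k * wilson k (of_real x) a b c h"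
    have bd: "pochhammer (b + d) (k + m) = pochhammer (b + d) k * pochhammer (of_nat k + b + d) m" for m
      by (simp add: pochhammer_product' add_ac)
    have row: "(\<lambda>m. f (k, m)) summable_on UNIV"
      using summable_on_SigmaD1[of "\<lambda>k m. f (k, m)" UNIV "\<lambda>_. UNIV" k] f by (simp add: case_prod_eta)
    have *: "((\<lambda>m. f (k, m)) has_sum (T * F * W)) UNIV"
      if F: "F = (\<Sum>m. g m)" and g: "\<And>m. f (k, m) = T * W * g m" for F g
    proof -
      have "((\<lambda>m. f (k, m)) has_sum (\<Sum>\<^sub>\<infinity>m. f (k, m))) UNIV"
        using row by (rule has_sum_infsum)
      show ?thesis
      \<comment> \<open>Summability of \<open>g\<close> can be inferred from that of the row only if
        \<open>T * W\<close> is nonzero. Otherwise the row is identically 0 and the value of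
        \<open>F\<close> does not matter.\<close>
      proof (cases "T * W = 0")
        case True
        then show ?thesis unfolding g by auto
      next
        case False
        then have "g summable_on UNIV" using row unfolding g by (subst (asm) summable_on_cmult_right') auto
        then have "(g has_sum (\<Sum>m. g m)) UNIV"
          by (metis has_sum_imp_sums has_sum_infsum sums_unique)
        then have "((\<lambda>m. T * W * g m) has_sum (T * W * (\<Sum>m. g m))) UNIV"
          by (rule has_sum_cmult_right)
        then show ?thesis unfolding g F by (simp add: mult_ac)
      qed
    qed
    have "((\<lambda>m. f (k, m)) has_sum (T * (if k = 0 \<and> a + b + c + d = 1
           then hypergeom
                  [d - h, a + b, b + c]
                  [a + b + c + h, b + d] \<rho>
           else hypergeom
                  [d - h, of_nat (2 * k) + a + b + c + d - 1, of_nat k + a + b, of_nat k + b + c]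
                  [of_nat k + a + b + c + d - 1, of_nat (2 * k) + a + b + c + h, of_nat k + b + d] \<rho>) * W)) UNIV"
    proof (cases "k = 0 \<and> a + b + c + d = 1")
      case True
      show ?thesis
        unfolding if_P[OF True] hypergeom_def
        by (rule *[OF refl]) (use True in \<open>simp add: f_def connection_coeff_def T_def W_def mult_ac\<close>)
    next
      case False
      show ?thesis
        unfolding if_not_P[OF False] hypergeom_def
      proof (rule *[OF refl])
        fix m
        define s where "s = of_nat k + a + b + c + d - 1"
        \<comment> \<open>For \<open>k = 0\<close> the first factor \<open>a + b + c + d - 1\<close>
          is nonzero by the case assumption, and all later factors have positive real part.\<close>
        have "pochhammer s m \<noteq> 0"
        proof (cases "k = 0")
          case True
          with False have "a + b + c + d - 1 \<noteq> 0" by simp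
          moreover have "pochhammer (a + b + c + d) n \<noteq> 0" for n
            using pos by (intro pochhammer_nonzero) simp
          ultimately show ?thesis
            using True by (cases m) (simp_all add: s_def pochhammer_rec)
        next
          case False
          then have "Re s > 0" using pos by (simp add: s_def)
          then show ?thesis by (rule pochhammer_nonzero)
        qed
        moreover have "pochhammer s k * pochhammer (of_nat (2 * k) + a + b + c + d - 1) m =
            pochhammer s m * pochhammer (of_nat (k + m) + a + b + c + d - 1) k"
          using pochhammer_product'[of s k m] pochhammer_product'[of s m k]
          by (simp add: s_def algebra_simps)
        ultimately have s: "pochhammer (of_nat (k + m) + a + b + c + d - 1) k =
            pochhammer s k * pochhammer (of_nat (2 * k) + a + b + c + d - 1) m / pochhammer s m"
          by (simp add: field_simps)
        show "f (k, m) = T * W * ((\<Prod>a\<leftarrow>[d - h, of_nat (2 * k) + a + b + c + d - 1, of_nat k + a + b, of_nat k + b + c]. pochhammer a m) /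
            (\<Prod>b\<leftarrow>[of_nat k + a + b + c + d - 1, of_nat (2 * k) + a + b + c + h, of_nat k + b + d]. pochhammer b m) * (\<rho> ^ m / fact m))"
          unfolding f_def prod.case connection_coeff_def s T_def W_def s_def[symmetric] bd
          by (simp add: power_add mult_ac)
      qed
    qed
    then show "((\<lambda>m. f (k, m)) has_sum ?term k) UNIV"
      unfolding T_def W_def by (simp only: mult.assoc)
  qed
  then show ?thesis
    unfolding S by (rule has_sum_imp_sums)
qed

end
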